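(* For every integer $k\ge 1$ we have $f(k)\le k+4$. Moreover: (1) $f(k)=k+4$ if and only if $k=2^{2r}-1$ for some integer $r\ge 1$; (2) there is no $k\ge1$ with $f(k)=k+3$ or $f(k)=k+2$; (3) $f(k)=k+1$ if and only if $k=6$; (4) $f(k)=k$ if and only if $k=1$ or $k=2^r+1$ for some integer $r\ge 2$.
   Context: For a non-negative integer $n$, let $s_2(n)$ denote the sum of the binary digits of $n$, and let $t_n = s_2(n) \bmod 2$ (the Thue–Morse sequence). For $k\ge1$ let $\mathcal{N}_k=\{n\ge 0: t_{kn}=1\}$ and $f(k)=\min \mathcal{N}_k$ (this minimum exists for every $k \ge 1$). *)

theory Defs
  imports Main
begin

fun s2 :: "nat \<Rightarrow> nat" where
  "s2 n = (if n = 0 then 0 else n mod 2 + s2 (n div 2))"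

declare s2.simps [simp del]

definition thue_morse :: "nat \<Rightarrow> nat" where
  "thue_morse n = s2 n mod 2"

definition N_set :: "nat \<Rightarrow> nat set" where
  "N_set k = {n. thue_morse (k * n) = 1}"

definition f_min :: "nat \<Rightarrow> nat" where
  "f_min k = (LEAST n. n \<in> N_set k)"

text \<open>The set is nonempty for \<open>k \<ge> 1\<close>, so \<open>f_min k\<close> is a genuine minimum: the number
  \<open>k * (2^m - 1)\<close> has digit sum \<open>m\<close> whenever \<open>1 \<le> k \<le> 2^m\<close>.\<close>

lemma s2_0 [simp]: "s2 0 = 0"
  by (simp add: s2.simps)

lemma s2_rec: "s2 n = n mod 2 + s2 (n div 2)"
  by (cases "n = 0") (simp_all add: s2.simps[of n])

lemma s2_append: "b < 2 ^ m \<Longrightarrow> s2 (a * 2 ^ m + b) = s2 a + s2 b"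
proof (induction m arbitrary: b)
  case 0
  then show ?case by simp
next
  case (Suc m)
  have eq: "a * 2 ^ Suc m + b = b + 2 * (a * 2 ^ m)" by simp
  have "s2 (a * 2 ^ Suc m + b) = b mod 2 + s2 (a * 2 ^ m + b div 2)"
    unfolding eq by (subst s2_rec) (simp add: add.commute)
  also have "\<dots> = b mod 2 + (s2 a + s2 (b div 2))"
    using Suc by simp
  finally show ?case using s2_rec[of b] by simp
qed

lemma s2_complement: "c < 2 ^ m \<Longrightarrow> s2 c + s2 (2 ^ m - 1 - c) = m"
proof (induction m arbitrary: c)
  case 0
  then show ?case by simp
next
  case (Suc m)
  define d where "d = 2 ^ Suc m - 1 - c"
  define q where "q = 2 ^ m - 1 - c div 2"
  have lt: "c div 2 < 2 ^ m" using Suc.prems by simp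
  have q: "q + c div 2 + 1 = 2 ^ m" using lt by (simp add: q_def)
  have "d + c + 1 = 2 * 2 ^ m" using Suc.prems by (simp add: d_def)
  then have "d + c + 1 = 2 * (q + c div 2 + 1)" by (simp only: q)
  then have "d div 2 = q" "d mod 2 + c mod 2 = 1" by presburger+
  moreover have "s2 (c div 2) + s2 q = m" using Suc.IH[OF lt] by (simp add: q_def)
  ultimately show ?case
    unfolding d_def[symmetric] using s2_rec[of c] s2_rec[of d] by simp
qed

lemma N_set_nonempty:
  assumes "k \<ge> 1"
  shows "N_set k \<noteq> {}"
proof -
  define m where "m = 2 * k + 1"
  have "k < 2 ^ k" by simp
  also have "(2::nat) ^ k \<le> 2 ^ m" by (rule power_increasing) (simp_all add: m_def)
  finally have lt: "k < 2 ^ m" .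
  have "k * (2 ^ m - 1) = k * 2 ^ m - k" by (simp add: diff_mult_distrib2)
  also have "\<dots> = (k - 1) * 2 ^ m + (2 ^ m - 1 - (k - 1))"
    using assms lt by (cases k) simp_all
  finally have "s2 (k * (2 ^ m - 1)) = s2 (k - 1) + s2 (2 ^ m - 1 - (k - 1))"
    using s2_append[of "2 ^ m - 1 - (k - 1)" m "k - 1"] by simp
  also have "\<dots> = m" using s2_complement[of "k - 1" m] lt by simp
  finally have "thue_morse (k * (2 ^ m - 1)) = 1"
    by (simp add: thue_morse_def m_def)
  then show ?thesis unfolding N_set_def by blast
qed

end

theory Submission imports Defs begin

text \<open>Let \<open>k\<close> be odd with \<open>2^L < k < 2^(L+1)\<close>. If \<open>k m = P 2^L + Q\<close> with \<open>Q < 2^L\<close>, then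
  \<open>k (2^L + m) = (k + P) 2^L + Q\<close>, so one of \<open>m\<close> and \<open>2^L + m\<close> lies in \<open>\<N>\<^sub>k\<close> as soon as
  \<open>t\<close> differs at \<open>k + P\<close> and \<open>P\<close>. Write \<open>k + 1 = 2^v (2 c + 1)\<close> with \<open>c \<ge> 1\<close> and assume
  \<open>t\<^sub>k = 0\<close>, the case \<open>t\<^sub>k = 1\<close> being trivial. For odd \<open>v\<close> the choice \<open>m = 1\<close>, \<open>P = 1\<close> works. For
  even \<open>v\<close> the values of \<open>t\<close> at \<open>k + P\<close> for small \<open>P\<close> are known from those at \<open>c\<close>, \<open>c + 1\<close> and
  \<open>c + 2\<close>, and a suitable small \<open>m\<close> is found according to the size of \<open>(2^(L+1) - k) / 2^L\<close>.
  The exceptional \<open>k\<close> are computed directly, and even \<open>k\<close> reduce to \<open>k / 2\<close>.\<close>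

section \<open>Digit sums of doubles, numerals and complements\<close>

lemma s2_1 [simp]: "s2 (Suc 0) = 1"
  by (simp add: s2.simps)

lemma s2_double [simp]: "s2 (2 * n) = s2 n"
  by (subst s2_rec) simp

lemma s2_Suc_double [simp]: "s2 (Suc (2 * n)) = Suc (s2 n)"
  by (subst s2_rec) simp

lemma s2_numeral [simp]:
  "s2 (numeral (Num.Bit0 n)) = s2 (numeral n)"
  "s2 (numeral (Num.Bit1 n)) = Suc (s2 (numeral n))"
  "s2 (numeral Num.One) = 1"
proof -
  show "s2 (numeral (Num.Bit0 n)) = s2 (numeral n)"
    by (metis s2_double mult_2 numeral_Bit0)
  show "s2 (numeral (Num.Bit1 n)) = Suc (s2 (numeral n))"
    by (metis s2_Suc_double mult_2 numeral_Bit1 Suc_eq_plus1)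
qed simp

lemma s2_power2_diff: "1 \<le> c \<Longrightarrow> c \<le> 2 ^ m \<Longrightarrow> s2 (2 ^ m - c) + s2 (c - 1) = m"
  using s2_complement[of "c - 1" m] by (cases c) (simp_all add: add.commute)

text \<open>The lower \<open>m\<close> bits of the product are the complement of its upper part
  \<open>n - 1\<close>, so the two digit sums add up to \<open>m\<close>.\<close>

lemma s2_mult_power2_minus_1:
  assumes "1 \<le> n" "n \<le> 2 ^ m"
  shows "s2 ((2 ^ m - 1) * n) = m"
proof -
  have "(2 ^ m - 1) * n = (n - 1) * 2 ^ m + (2 ^ m - n)"
  proof -
    obtain i where i: "n = Suc i" using assms(1) by (cases n) auto
    obtain d where d: "2 ^ m = n + d" using assms(2) le_Suc_ex by blast
    show ?thesis unfolding d i by (simp add: add_mult_distrib add_mult_distrib2)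
  qed
  then show ?thesis
    using s2_append[of "2 ^ m - n" m "n - 1"] s2_power2_diff[of n m] assms by simp
qed

section \<open>Witnesses from the leading part of a product\<close>

text \<open>Since \<open>k * m = 2 * m * 2 ^ L - X * m\<close> and \<open>h\<close> is
  \<open>X * m / 2 ^ L\<close> rounded up, \<open>P = 2 * m - h\<close> is the quotient of
  \<open>k * m\<close> by \<open>2 ^ L\<close>. Later instances list \<open>m\<close>,
  \<open>h\<close>, \<open>P\<close> in this order.\<close>

lemma witness_by_prefix:
  assumes "k + X = 2 * 2 ^ L" and "X * m \<le> h * 2 ^ L" and "h * 2 ^ L < X * m + 2 ^ L"
    and "2 ^ L + m < k" and "P + h = 2 * m" and "even (s2 (k + P)) \<noteq> even (s2 P)"
  shows "\<exists>n<k. odd (s2 (k * n))"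
proof -
  define Q where "Q = h * 2 ^ L - X * m"
  have Q: "Q < 2 ^ L" "Q + X * m = h * 2 ^ L" using assms(2,3) by (auto simp: Q_def)
  have "k * m + X * m = (P + h) * 2 ^ L"
    unfolding assms(5) add_mult_distrib[symmetric] assms(1) by (simp add: mult_ac)
  then have km: "k * m = P * 2 ^ L + Q" using Q(2) by (simp add: add_mult_distrib)
  then have "k * (2 ^ L + m) = (k + P) * 2 ^ L + Q" by (simp add: algebra_simps)
  then have "s2 (k * (2 ^ L + m)) = s2 (k + P) + s2 Q" using s2_append[OF Q(1)] by simp
  moreover have "s2 (k * m) = s2 P + s2 Q" using s2_append[OF Q(1)] km by simp
  ultimately have "odd (s2 (k * m)) \<or> odd (s2 (k * (2 ^ L + m)))" using assms(6) by auto
  moreover have "m < k" using assms(4) by simp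
  ultimately show ?thesis using assms(4) by blast
qed

lemma power2_times_odd:
  fixes n :: nat
  assumes "n > 0"
  shows "\<exists>v c. n = 2 ^ v * (2 * c + 1)"
  using assms
proof (induction n rule: less_induct)
  case (less n)
  show ?case
  proof (cases "even n")
    case True
    then obtain m where m: "n = 2 * m" by auto
    then obtain v c where "m = 2 ^ v * (2 * c + 1)" using less.IH[of m] less.prems by auto
    then have "n = 2 ^ Suc v * (2 * c + 1)" using m by simp
    then show ?thesis by blast
  next
    case False
    then obtain c where "n = 2 ^ 0 * (2 * c + 1)" by (auto elim: oddE)
    then show ?thesis by blast
  qed
qed

section \<open>Odd k with an even number of trailing ones\<close>

text \<open>The case \<open>v = 2\<close> stands apart: the choice \<open>P = 2 * W + 4\<close> made
  for larger \<open>v\<close> would be \<open>8\<close>, of digit sum 1 instead of 2. Splitting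
  \<open>X / 2 ^ L\<close> at 1/3 and 2/5 fixes how \<open>X * m / 2 ^ L\<close> rounds.\<close>

lemma witness_two_trailing_ones:
  assumes k: "k = 8 * c + 3" and X: "k + X = 2 * 2 ^ L" and X2: "2 * X \<le> 2 ^ L"
    and small: "16 \<le> (2::nat) ^ L" and c: "even (s2 c)" and c1: "odd (s2 (c + 1))"
  shows "\<exists>n<k. odd (s2 (k * n))"
proof -
  note w = witness_by_prefix[OF X]
  have ap: "s2 (a * 8 + b) = s2 a + s2 b" if "b < 8" for a b
    using s2_append[of b 3 a] that by simp
  have "X > 0"
  proof (rule ccontr)
    assume "\<not> X > 0"
    then have "even k" using X by simp
    then show False using k by simp
  qed
  consider "3 * X \<le> 2 ^ L" | "2 * 2 ^ L < 5 * X" | "2 ^ L < 3 * X" "5 * X \<le> 2 * 2 ^ L"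
    by linarith
  then show ?thesis
  proof cases
    case 1
    have "k + 5 = (c + 1) * 8 + 0" using k by simp
    then have "s2 (k + 5) = s2 (c + 1)" by (simp only: ap) simp
    then show ?thesis
      using w[of 3 1 5] 1 X X2 small c1 \<open>X > 0\<close> by simp
  next
    case 2
    have "k + 7 = (c + 1) * 8 + 2" using k by simp
    then have "s2 (k + 7) = s2 (c + 1) + 1" by (simp only: ap) simp
    then show ?thesis
      using w[of 5 3 7] 2 X X2 small c1 by simp
  next
    case 3
    \<comment> \<open>For \<open>L = 4\<close> the bounds leave only \<open>X = 6\<close>, so
      \<open>k = 26\<close>, which is not 3 modulo 8. From \<open>2 ^ L \<ge> 32\<close> on there is
      room for \<open>m = 10\<close>.\<close>
    have "L \<noteq> 4"
    proof
      assume "L = 4"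
      then show False using 3 X k by simp presburger
    qed
    moreover have "3 < L" by (rule ccontr) (use small power_increasing[of L 3 "2::nat"] in simp)
    ultimately have "(2::nat) ^ 5 \<le> 2 ^ L" by (intro power_increasing) auto
    then have L: "32 \<le> (2::nat) ^ L" by simp
    show ?thesis
    \<comment> \<open>The carry reaches \<open>c + 2\<close>, of unknown parity. Both
      \<open>P = 16\<close> and \<open>P = 14\<close> have odd digit sum, but they leave the
      remainders 3 and 1 of opposite parity, so one of them fits.\<close>
    proof (cases "even (s2 (c + 2))")
      case True
      have "k + 16 = (c + 2) * 8 + 3" using k by simp
      then have "s2 (k + 16) = s2 (c + 2) + 2" by (simp only: ap) simp
      then show ?thesis
        using w[of 10 4 16] 3 X X2 L True by simp
    next
      case False
      have "k + 14 = (c + 2) * 8 + 1" using k by simp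
      then have "s2 (k + 14) = s2 (c + 2) + 1" by (simp only: ap) simp
      then show ?thesis
        using w[of 9 4 14] 3 X X2 L False by simp
    qed
  qed
qed

text \<open>If \<open>X\<close> exceeds \<open>2 ^ L / W\<close>, a power of two serves as
  \<open>m\<close> without any carry into \<open>c\<close>. For smaller \<open>X\<close> the carry
  reaches \<open>c + 1\<close>, whose parity decides the choice.\<close>

lemma witness_even_trailing_ones:
  assumes k: "k + 1 = 2 ^ v * (2 * c + 1)" and v: "even v" "2 \<le> v" and "1 \<le> c"
    and c: "even (s2 c)" and L: "2 ^ L < k" and X: "k + X = 2 * 2 ^ L" and "0 < X"
  shows "\<exists>n<k. odd (s2 (k * n))"
proof -
  note w = witness_by_prefix[OF X]
  define W :: nat where "W = 2 ^ (v - 1)"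
  have V: "2 ^ v = 2 * W" using v(2) by (cases v) (simp_all add: W_def)
  have W2: "2 \<le> W" using power_increasing[of 1 "v - 1" "2::nat"] v(2) by (simp add: W_def)
  have k': "k + 1 = 4 * W * c + 2 * W" using k V by (simp add: algebra_simps)
  have ap: "s2 (a * (2 * W) + b) = s2 a + s2 b" if "b < 2 * W" for a b
    using s2_append[of b v a] that V by simp
  have ap2: "s2 (a * (4 * W) + b) = s2 a + s2 b" if "b < 4 * W" for a b
    using s2_append[of b "Suc v" a] that V by simp
  have "v < L"
  proof (rule ccontr)
    assume "\<not> v < L"
    then have "(2::nat) ^ L \<le> 2 ^ v" by (intro power_increasing) auto
    moreover have "4 * W * 1 \<le> 4 * W * c" using \<open>1 \<le> c\<close> by (intro mult_le_mono2)
    ultimately show False using k' V X \<open>0 < X\<close> W2 by linarith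
  qed
  then obtain e where "L = Suc v + e" using less_iff_Suc_add by auto
  then have B: "2 ^ L = 4 * W * 2 ^ e" using V by (simp add: power_add)
  show ?thesis
  proof (cases "X * W \<le> 2 ^ L")
    case False
    \<comment> \<open>Doubling \<open>X\<close> until it first exceeds \<open>2 ^ L\<close> keeps it
      at most \<open>2 * 2 ^ L\<close>, so \<open>m = 2 ^ j\<close> has
      \<open>h = 2\<close>.\<close>
    define j where "j = (LEAST j. 2 ^ L < X * 2 ^ j)"
    have j1: "2 ^ L < X * 2 ^ j" unfolding j_def
      by (rule LeastI[of _ "v - 1"]) (use False in \<open>simp add: W_def\<close>)
    have jv: "j \<le> v - 1" unfolding j_def
      by (rule Least_le) (use False in \<open>simp add: W_def\<close>)
    have "j \<noteq> 0" using j1 X L by (intro notI) simp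
    then obtain i where i: "j = Suc i" by (cases j) auto
    have "\<not> 2 ^ L < X * 2 ^ i"
      using not_less_Least[of i "\<lambda>j. 2 ^ L < X * 2 ^ j"] i j_def by simp
    then have j2: "X * 2 ^ j \<le> 2 * 2 ^ L" using i by simp
    have jW: "2 ^ j \<le> W" unfolding W_def using jv by (intro power_increasing) auto
    have lt: "2 ^ L + 2 ^ j < k"
    proof -
      have "4 * W * 2 ^ e < 4 * W * c + 2 * W" using L k' B by linarith
      then have "2 * W * (2 * 2 ^ e) < 2 * W * (2 * c + 1)" by (simp add: algebra_simps)
      then have "2 ^ e \<le> c" unfolding mult_less_cancel1 by linarith
      then have "4 * W * 2 ^ e \<le> 4 * W * c" by (intro mult_le_mono2)
      then show ?thesis using k' B jW W2 by linarith
    qed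
    have four: "4 \<le> (2::nat) ^ Suc j" using i by simp
    define P :: nat where "P = 2 ^ Suc j - 2"
    have P: "P + 2 = 2 * 2 ^ j" using four by (simp add: P_def)
    \<comment> \<open>Both \<open>2 ^ Suc j - 3\<close> and \<open>P\<close> have digit sum
      \<open>j\<close>; the final one of \<open>2 * c + 1\<close> makes the parities differ.\<close>
    have "k + P = (2 * c + 1) * (2 * W) + (2 ^ Suc j - 3)"
      using k' P four by (simp add: algebra_simps)
    moreover have "2 ^ Suc j - 3 < 2 * W" using jW W2 by simp
    ultimately have "s2 (k + P) = s2 c + 1 + s2 (2 ^ Suc j - 3)" by (simp only: ap) simp
    moreover have "s2 (2 ^ Suc j - 3) + 1 = Suc j"
      using s2_power2_diff[of 3 "Suc j"] four by simp
    moreover have "s2 P + 1 = Suc j"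
      using s2_power2_diff[of 2 "Suc j"] four by (simp add: P_def)
    ultimately have "even (s2 (k + P)) \<noteq> even (s2 P)" using c by simp
    then show ?thesis using w[of "2 ^ j" 2 P] j1 j2 lt P by simp
  next
    case True
    have X2: "2 * X \<le> 2 ^ L"
      using True mult_le_mono2[OF W2, of X] by linarith
    \<comment> \<open>\<open>k + 1\<close> is an odd multiple of \<open>2 * W\<close> and
      \<open>2 * 2 ^ L\<close> an even one, hence \<open>2 * W < X\<close> and
      \<open>2 * W * W < 2 ^ L\<close>. Both sides are powers of two, which gains a factor
      2.\<close>
    have large: "4 * W * W \<le> 2 ^ L"
    proof -
      have "4 * W * c + 2 * W \<le> 8 * W * 2 ^ e" using k' X B \<open>0 < X\<close> by linarith
      then have "2 * W * (2 * c + 1) \<le> 2 * W * (4 * 2 ^ e)" by (simp add: algebra_simps)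
      then have "2 * c + 1 \<le> 4 * 2 ^ e" unfolding mult_le_cancel1 using W2 by linarith
      then have "2 * c + 2 \<le> 4 * 2 ^ e" by presburger
      then have "2 * W * (2 * c + 2) \<le> 2 * W * (4 * 2 ^ e)" by (intro mult_le_mono2)
      then have "2 * W < X" using k' X B by (simp add: algebra_simps)
      then have "2 * W * W < 2 ^ L"
        using True W2 mult_less_mono1[of "2 * W" X W] by linarith
      then have "2 * W * W < 2 * W * (2 * 2 ^ e)" using B by simp
      then have "W < 2 ^ Suc e" unfolding mult_less_cancel1 by simp
      then have "v - 1 < Suc e" unfolding W_def
        by (rule power_less_imp_less_exp[rotated]) simp
      then have "W \<le> 2 ^ e" unfolding W_def by (intro power_increasing) auto
      then have "4 * W * W \<le> 4 * W * 2 ^ e" by (intro mult_le_mono2)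
      then show ?thesis using B by simp
    qed
    have "2 * W + 4 \<le> 2 * W * W"
    proof -
      have "2 * W * 2 \<le> 2 * W * W" using W2 by (intro mult_le_mono2)
      then show ?thesis using W2 by linarith
    qed
    then have lt: "2 ^ L + m < k" if "m \<le> 2 * W + 3" for m
      using that large X X2 by linarith
    show ?thesis
    proof (cases "even (s2 (c + 1))")
      case c1: False
      show ?thesis
      proof (cases "v = 2")
        case True
        then have "W = 2" by (simp add: W_def)
        then have "k = 8 * c + 3" "16 \<le> (2::nat) ^ L" using k' large by simp_all
        then show ?thesis using witness_two_trailing_ones[OF _ X X2 _ c] c1 by blast
      next
        case False
        then have "v \<ge> 4" using v by presburger
        then have "(2::nat) ^ 3 \<le> 2 ^ (v - 1)" by (intro power_increasing) auto
        then have W8: "8 \<le> W" by (simp add: W_def)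
        have X8: "8 * X \<le> 2 ^ L"
          using \<open>X * W \<le> 2 ^ L\<close> mult_le_mono2[OF W8, of X] by linarith
        show ?thesis
        \<comment> \<open>\<open>P = 2 * W + 1\<close> lifts \<open>k\<close> exactly to
          \<open>(c + 1) * (4 * W)\<close>. If \<open>m = W + 1\<close> rounds too high for it,
          \<open>m = W + 3\<close> overshoots by 3, whose two ones keep the parity.\<close>
        proof (cases "X * (W + 1) \<le> 2 ^ L")
          case True
          have "k + (2 * W + 1) = (c + 1) * (4 * W) + 0" using k' by (simp add: algebra_simps)
          then have "s2 (k + (2 * W + 1)) = s2 (c + 1)" using W2 by (simp only: ap2) simp
          moreover have "s2 (2 * W + 1) = 2" using ap[of 1 1] W2 by simp
          ultimately show ?thesis
            using w[of "W + 1" 1 "2 * W + 1"] True lt[of "W + 1"] c1 \<open>0 < X\<close> by simp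
        next
          case False
          have "k + (2 * W + 4) = (c + 1) * (4 * W) + 3" using k' by (simp add: algebra_simps)
          then have "s2 (k + (2 * W + 4)) = s2 (c + 1) + 2" using W2 by (simp only: ap2) simp
          moreover have "s2 (2 * W + 4) = 2" using ap[of 4 1] W8 by simp
          moreover have "X * (W + 3) \<le> 2 * 2 ^ L" "2 ^ L < X * (W + 3)"
            using False \<open>X * W \<le> 2 ^ L\<close> X8 by (simp_all add: algebra_simps)
          ultimately show ?thesis
            using w[of "W + 3" 2 "2 * W + 4"] lt[of "W + 3"] c1 by simp
        qed
      qed
    next
      case c1: True
      have X2W: "X * (2 * W) \<le> 2 * 2 ^ L" using \<open>X * W \<le> 2 ^ L\<close> by simp
      show ?thesis
      \<comment> \<open>The next power of two, \<open>m = 2 * W\<close>, again has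
        \<open>h = 2\<close> in the first case; the digit sums of \<open>2 * W - 3\<close> and
        \<open>P\<close> are now \<open>v - 1\<close> and \<open>v\<close>.\<close>
      proof (cases "2 ^ L < X * (2 * W)")
        case True
        define P where "P = 4 * W - 2"
        have P: "P + 2 = 2 * (2 * W)" using W2 by (simp add: P_def)
        have "k + P = (c + 1) * (4 * W) + (2 * W - 3)"
          using k' P W2 by (simp add: algebra_simps)
        then have "s2 (k + P) = s2 (c + 1) + s2 (2 * W - 3)"
          using ap2[of "2 * W - 3" "c + 1"] W2 by simp
        moreover have "s2 (2 * W - 3) + 1 = v"
          using s2_power2_diff[of 3 v] V W2 by simp
        moreover have "s2 P + 1 = Suc v"
          using s2_power2_diff[of 2 "Suc v"] V W2 by (simp add: P_def)
        ultimately have "even (s2 (k + P)) \<noteq> even (s2 P)"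
          using c1 v by (metis add_Suc_right even_Suc even_add nat.inject Suc_eq_plus1)
        then show ?thesis using w[of "2 * W" 2 P] True X2W lt[of "2 * W"] P by simp
      next
        case small: False
        have c3: "s2 (2 * c + 3) = s2 (c + 1) + 1"
          using s2_Suc_double[of "c + 1"] by (simp add: numeral_3_eq_3)
        show ?thesis
        \<comment> \<open>The pattern of \<open>W + 1\<close> and \<open>W + 3\<close> recurs with
          \<open>2 * W\<close> for \<open>W\<close>: the carry now produces
          \<open>2 * c + 3\<close>, of odd digit sum.\<close>
        proof (cases "X * (2 * W + 1) \<le> 2 ^ L")
          case True
          have "k + (4 * W + 1) = (2 * c + 3) * (2 * W) + 0" using k' by (simp add: algebra_simps)
          then have "s2 (k + (4 * W + 1)) = s2 (c + 1) + 1" using W2 by (simp only: ap c3) simp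
          moreover have "s2 (4 * W + 1) = 2" using ap2[of 1 1] W2 by simp
          ultimately show ?thesis
            using w[of "2 * W + 1" 1 "4 * W + 1"] True lt[of "2 * W + 1"] c1 \<open>0 < X\<close> by simp
        next
          case False
          have "k + (4 * W + 4) = (2 * c + 3) * (2 * W) + 3" using k' by (simp add: algebra_simps)
          then have "s2 (k + (4 * W + 4)) = s2 (c + 1) + 3" using W2 by (simp only: ap c3) simp
          moreover have "s2 (4 * W + 4) = 2" using ap2[of 4 1] W2 by simp
          moreover have "4 * X \<le> X * (2 * W)"
            using mult_le_mono2[OF W2, of "2 * X"] by linarith
          then have "X * (2 * W + 3) \<le> 2 * 2 ^ L" "2 ^ L < X * (2 * W + 3)"
            using False small unfolding add_mult_distrib2 by linarith+
          ultimately show ?thesis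
            using w[of "2 * W + 3" 2 "4 * W + 4"] lt[of "2 * W + 3"] c1 by simp
        qed
      qed
    qed
  qed
qed

section \<open>Odd k outside the exceptional families\<close>

lemma witness_odd:
  assumes "odd k" "k \<noteq> 1" "\<And>r. r \<ge> 1 \<Longrightarrow> k \<noteq> 2 ^ (2 * r) - 1"
    and r1: "\<And>r. r \<ge> 2 \<Longrightarrow> k \<noteq> 2 ^ r + 1"
  shows "\<exists>n<k. odd (s2 (k * n))"
proof (cases "even (s2 k)")
  case False
  then show ?thesis using assms(1,2) by (intro exI[of _ 1]) (auto elim: oddE)
next
  case True
  have "k \<noteq> 3" using assms(3)[of 1] by simp
  then have k5: "k \<ge> 5" using assms(1,2) by presburger
  obtain L where L: "2 ^ L \<le> k" "k < 2 ^ (L + 1)"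
    using ex_power_ivl1[of 2 k] k5 by auto
  have L2: "L \<ge> 2"
  proof (rule ccontr)
    assume "\<not> L \<ge> 2"
    then have "(2::nat) ^ (L + 1) \<le> 2 ^ 2" by (intro power_increasing) auto
    then show False using L k5 by simp
  qed
  then have "even ((2::nat) ^ L)" by simp
  then have "k \<noteq> 2 ^ L" using assms(1) by metis
  \<comment> \<open>Excluding \<open>2 ^ r + 1\<close> leaves room for the choice
    \<open>m = 1\<close>.\<close>
  then have L1: "2 ^ L + 1 < k" using L r1[OF L2] by linarith
  define X where "X = 2 * 2 ^ L - k"
  have X: "k + X = 2 * 2 ^ L" "0 < X" using L by (simp_all add: X_def)
  \<comment> \<open>\<open>v\<close> counts the trailing ones of \<open>k\<close>; \<open>c\<close>
    consists of the bits above them and the zero that ends them.\<close>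
  obtain v c where vc: "k + 1 = 2 ^ v * (2 * c + 1)" using power2_times_odd[of "k + 1"] by auto
  have v: "v \<noteq> 0" using vc assms(1) by (intro notI) simp
  have "k = (2 * c) * 2 ^ v + (2 ^ v - 1)" using vc by (simp add: algebra_simps)
  moreover have "s2 (2 ^ v - 1) = v" using s2_power2_diff[of 1 v] by simp
  ultimately have sk: "s2 k = s2 c + v" using s2_append[of "2 ^ v - 1" v "2 * c"] by simp
  show ?thesis
  proof (cases "even v")
    case False
    have "s2 (k + 1) = s2 c + 1"
      unfolding vc using s2_append[of 0 v "2 * c + 1"] by (simp add: mult.commute[of _ "2 ^ v"])
    then show ?thesis
      using witness_by_prefix[OF X(1), of 1 1 1] L1 X False sk True by simp
  next
    case ev: True
    have "c \<noteq> 0"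
    proof
      assume "c = 0"
      then have "k = 2 ^ (2 * (v div 2)) - 1" using vc ev by simp
      then show False using assms(3)[of "v div 2"] v ev by auto
    qed
    moreover have "2 \<le> v" using v ev by presburger
    ultimately show ?thesis
      using witness_even_trailing_ones[OF vc ev _ _ _ _ X] True ev sk L1 by simp
  qed
qed

section \<open>Values of the minimum at the exceptional k\<close>

lemma f_min_eq:
  assumes "odd (s2 (k * m))" "\<And>n. n < m \<Longrightarrow> even (s2 (k * n))"
  shows "f_min k = m"
  unfolding f_min_def
proof (rule Least_equality)
  show "m \<in> N_set k" using assms(1) by (simp add: N_set_def thue_morse_def odd_iff_mod_2_eq_one)
  show "m \<le> n" if "n \<in> N_set k" for n
    using that assms(2)[of n]
    by (force simp: N_set_def thue_morse_def even_iff_mod_2_eq_zero not_less[symmetric])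
qed

lemma f_min_le: "odd (s2 (k * n)) \<Longrightarrow> f_min k \<le> n"
  unfolding f_min_def
  by (rule Least_le) (simp add: N_set_def thue_morse_def odd_iff_mod_2_eq_one)

lemma f_min_double: "f_min (2 * k) = f_min k"
  by (simp add: f_min_def N_set_def thue_morse_def mult.assoc)

lemma f_min_1: "f_min 1 = 1"
  by (rule f_min_eq) auto

text \<open>For \<open>n < 2 ^ r\<close> the product repeats the bits of \<open>n\<close> twice. The
  square has ones at the places \<open>2 * r\<close>, \<open>r + 1\<close> and 0, which are distinct
  because \<open>r \<ge> 2\<close>.\<close>

lemma f_min_power2_plus_1:
  assumes "r \<ge> 2"
  shows "f_min (2 ^ r + 1) = 2 ^ r + 1"
proof (rule f_min_eq)
  have "(2::nat) ^ 2 \<le> 2 ^ r" using assms by (intro power_increasing) auto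
  then have r4: "4 \<le> (2::nat) ^ r" by simp
  have "(2 ^ r + 1) * (2 ^ r + 1) = (2 ^ r + 2) * 2 ^ r + (1::nat)" by (simp add: algebra_simps)
  moreover have "s2 (2 ^ r + 2) = 2" using s2_append[of 2 r 1] r4 by simp
  ultimately show "odd (s2 ((2 ^ r + 1) * (2 ^ r + 1)))"
    using s2_append[of 1 r "2 ^ r + 2"] r4 by simp
  fix n :: nat
  assume "n < 2 ^ r + 1"
  then consider "n < 2 ^ r" | "n = 2 ^ r" by linarith
  then show "even (s2 ((2 ^ r + 1) * n))"
  proof cases
    case 1
    then show ?thesis using s2_append[of n r n] by (simp add: algebra_simps)
  next
    case 2
    have "s2 (2 ^ r + 1) = 2" using s2_append[of 1 r 1] r4 by simp
    then show ?thesis using s2_append[of 0 r "2 ^ r + 1"] 2 by simp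
  qed
qed

text \<open>With \<open>M = 2 ^ (2 * r)\<close>, every \<open>n\<close> from 1 to \<open>M\<close>
  gives digit sum \<open>2 * r\<close>; then \<open>M + 1\<close>, \<open>M + 2\<close> and
  \<open>M + 3\<close> give \<open>4 * r\<close>, \<open>2 * r\<close> and
  \<open>2 * r + 1\<close>.\<close>

lemma f_min_power4_minus_1:
  assumes "r \<ge> 1"
  shows "f_min (2 ^ (2 * r) - 1) = 2 ^ (2 * r) - 1 + 4"
proof (rule f_min_eq)
  define M :: nat where "M = 2 ^ (2 * r)"
  have "(2::nat) ^ 2 \<le> M" unfolding M_def using assms by (intro power_increasing) auto
  then have M4: "4 \<le> M" by simp
  then obtain M' where M': "M = M' + 4" using le_Suc_ex by (metis add.commute)
  have ap: "s2 (a * M + b) = s2 a + s2 b" if "b < M" for a b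
    using s2_append[of b "2 * r" a] that by (simp add: M_def)
  have df: "s2 (M - a) + s2 (a - 1) = 2 * r" if "1 \<le> a" "a \<le> M" for a
    using s2_power2_diff[of a "2 * r"] that by (simp add: M_def)
  have "(M - 1) * (M - 1 + 4) = (M + 1) * M + (M - 3)" by (simp add: M' algebra_simps)
  moreover have "s2 (M + 1) = 2" using ap[of 1 1] M4 by simp
  ultimately have "s2 ((M - 1) * (M - 1 + 4)) + 1 = 2 + 2 * r"
    using ap[of "M - 3" "M + 1"] df[of 3] M4 by simp
  then show "odd (s2 ((2 ^ (2 * r) - 1) * (2 ^ (2 * r) - 1 + 4)))"
    unfolding M_def[symmetric] by presburger
  fix n :: nat
  assume "n < 2 ^ (2 * r) - 1 + 4"
  then consider "n = 0" | "1 \<le> n" "n \<le> M" | "n = M + 1" | "n = M + 2"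
    unfolding M_def[symmetric] using M4 by linarith
  then have "even (s2 ((M - 1) * n))"
  proof cases
    case 2
    then show ?thesis using s2_mult_power2_minus_1[of n "2 * r"] by (simp add: M_def)
  next
    case 3
    have "(M - 1) * (M + 1) = (M - 1) * M + (M - 1)" by (simp add: M' algebra_simps)
    then show ?thesis using ap[of "M - 1" "M - 1"] 3 M4 by simp
  next
    case 4
    have "(M - 1) * (M + 2) = M * M + (M - 2)" by (simp add: M' algebra_simps)
    moreover have "s2 M = 1" using ap[of 0 1] M4 by simp
    ultimately have "s2 ((M - 1) * (M + 2)) = 2 * r"
      using ap[of "M - 2" M] df[of 2] M4 by simp
    then show ?thesis using 4 by simp
  qed simp
  then show "even (s2 ((2 ^ (2 * r) - 1) * n))" by (simp add: M_def)
qed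

lemma f_min_6: "f_min 6 = 7"
  using f_min_double[of 3] f_min_power4_minus_1[of 1] by simp

section \<open>Classification of all k\<close>

lemma f_min_cases:
  assumes "k \<ge> 1"
  obtains (plus4) r where "r \<ge> 1" "k = 2 ^ (2 * r) - 1"
  | (one) "k = 1"
  | (same) r where "r \<ge> 2" "k = 2 ^ r + 1"
  | (six) "k = 6"
  | (less) "f_min k < k"
proof -
  have "(\<exists>r\<ge>1. k = 2 ^ (2 * r) - 1) \<or> k = 1 \<or> (\<exists>r\<ge>2. k = 2 ^ r + 1) \<or> k = 6 \<or> f_min k < k"
    using assms
  proof (induction k rule: less_induct)
    case (less k)
    show ?case
    proof (cases "even k")
      case False
      then show ?thesis using witness_odd[of k] f_min_le[of k] by (meson order.strict_trans1)
    next
      case True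
      then obtain m where m: "k = 2 * m" by auto
      then have "1 \<le> m" "m < k" using less.prems by auto
      \<comment> \<open>The bound \<open>f_min m \<le> m + 4\<close> is below \<open>2 * m\<close>
        from \<open>m = 5\<close> on. For \<open>m\<close> = 1, 2, 4 the number \<open>k\<close> is
        a power of two, and \<open>m = 3\<close> is the exception 6.\<close>
      consider "m = 1" | "m = 2" | "m = 3" | "m = 4" | "m \<ge> 5" using \<open>1 \<le> m\<close> by linarith
      then show ?thesis
      proof cases
        case 5
        have "f_min m \<le> m + 4"
          using less.IH[OF \<open>m < k\<close> \<open>1 \<le> m\<close>] f_min_6 f_min_1 f_min_power2_plus_1 f_min_power4_minus_1
          by (elim disjE exE conjE) simp_all
        then show ?thesis using 5 m f_min_double[of m] by simp
      qed (use m f_min_le[of k 1] in auto)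
    qed
  qed
  then show thesis using that by blast
qed

theorem theorem2:
  "(\<forall>k::nat. k \<ge> 1 \<longrightarrow> f_min k \<le> k + 4)
   \<and> (\<forall>k::nat. k \<ge> 1 \<longrightarrow> (f_min k = k + 4 \<longleftrightarrow> (\<exists>r::nat. r \<ge> 1 \<and> k = 2 ^ (2 * r) - 1)))
   \<and> \<not> (\<exists>k::nat. k \<ge> 1 \<and> (f_min k = k + 3 \<or> f_min k = k + 2))
   \<and> (\<forall>k::nat. k \<ge> 1 \<longrightarrow> (f_min k = k + 1 \<longleftrightarrow> k = 6))
   \<and> (\<forall>k::nat. k \<ge> 1 \<longrightarrow> (f_min k = k \<longleftrightarrow> k = 1 \<or> (\<exists>r::nat. r \<ge> 2 \<and> k = 2 ^ r + 1)))"
proof -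
  define A where "A k \<longleftrightarrow> (\<exists>r::nat. r \<ge> 1 \<and> k = 2 ^ (2 * r) - 1)" for k :: nat
  define B where "B k \<longleftrightarrow> k = 1 \<or> (\<exists>r::nat. r \<ge> 2 \<and> k = 2 ^ r + 1)" for k :: nat
  have A: "f_min k = k + 4" if "A k" for k
    using that f_min_power4_minus_1 unfolding A_def by blast
  have B: "f_min k = k" if "B k" for k
    using that f_min_1 f_min_power2_plus_1 unfolding B_def by blast
  have cases: "A k \<or> B k \<or> k = 6 \<or> f_min k < k" if "k \<ge> 1" for k
    using that by (cases k rule: f_min_cases) (auto simp: A_def B_def)
  \<comment> \<open>The classes give the distinct values \<open>k + 4\<close>, \<open>k\<close> and
    \<open>k + 1\<close>, or a value below \<open>k\<close>, so each value determines its
    class.\<close>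
  have "f_min k \<le> k + 4 \<and> (f_min k = k + 4 \<longleftrightarrow> A k) \<and> f_min k \<noteq> k + 3 \<and> f_min k \<noteq> k + 2
    \<and> (f_min k = k + 1 \<longleftrightarrow> k = 6) \<and> (f_min k = k \<longleftrightarrow> B k)" if "k \<ge> 1" for k
    using cases[OF that] A[of k] B[of k] f_min_6 by (cases "k = 6") auto
  then show ?thesis unfolding A_def B_def by blast
qed

end
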